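(* For all $n\in\mathbb{N}$, $$\Gamma^{p}_{\mathcal{R}(\rho,q)}(n+1)=(-1)^{n+1}\,\frac{[n]_{\mathcal{R}(\rho,q)}!}{[p]_{\mathcal{R}(\rho,q)}^{\lfloor n/p\rfloor}\;\big[\lfloor n/p\rfloor\big]_{\mathcal{R}(\rho^{p},q^{p})}!},$$ where $\lfloor\cdot\rfloor$ is the greatest integer function.
   Context: Let $p$ be a fixed odd prime, $\mathbb{C}_p$ the completion of an algebraic closure of $\mathbb{Q}_p$, and $\rho,q\in\mathbb{C}_p$ with $|\rho-1|_p<1$, $|q-1|_p<1$, $\rho\ne 1$, $q\neq 1$. The $\mathcal{R}(\rho,q)$-deformed numbers are $[n]_{\mathcal{R}(\rho,q)}=\mathcal{R}(\rho^n,q^n)\in\mathbb{C}_p$ for $n\ge 1$. The deformed numbers $[k]_{\mathcal{R}(\rho^{p},q^{p})}$, $k\ge 1$, attached to the parameters $(\rho^p,q^p)$ are related to them by the product rule $$[kp]_{\mathcal{R}(\rho,q)}=[k]_{\mathcal{R}(\rho^{p},q^{p})}\,[p]_{\mathcal{R}(\rho,q)}\qquad (k\ge 1)$$ (for example, in the case $[n]_{\mathcal{R}(\rho,q)}=\frac{\rho^n-q^n}{\rho-q}$ one has $[k]_{\mathcal{R}(\rho^p,q^p)}=\frac{\rho^{pk}-q^{pk}}{\rho^p-q^p}$). All the numbers $[n]_{\mathcal{R}(\rho,q)}$ and $[k]_{\mathcal{R}(\rho^p,q^p)}$ with $n,k\ge1$ are assumed nonzero. The factorials are $[0]_{\bullet}!=1$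 and $[n]_{\bullet}!=[1]_{\bullet}[2]_{\bullet}\cdots[n]_{\bullet}$ for $n\ge 1$, where $\bullet$ stands for $\mathcal{R}(\rho,q)$ or $\mathcal{R}(\rho^p,q^p)$. The $p$-adic $\mathcal{R}(\rho,q)$-gamma function on $\mathbb{Z}_p$ is $$\Gamma^{p}_{\mathcal{R}(\rho,q)}(x)=\lim_{n\to x}(-1)^{n}\prod_{\substack{1\le j<n\\ (p,j)=1}}[j]_{\mathcal{R}(\rho,q)},$$ the limit being taken $p$-adically over positive integers $n$ tending to $x$; it is the continuous extension to $\mathbb{Z}_p$, assumed to exist, of the function $n\mapsto(-1)^{n}\prod_{1\le j<n,\,(p,j)=1}[j]_{\mathcal{R}(\rho,q)}$, and at a positive integer $n$ its value is this finite product. *)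

theory Defs
  imports "HOL-Analysis.Analysis" "HOL-Computational_Algebra.Computational_Algebra"
begin

text \<open>A field with a multiplicative, ultrametric absolute value, given by its metric: the absolute
  value of \<open>x\<close> is \<open>dist x 0\<close>. (The constant \<open>norm\<close> is not used since the library constrains it
  to normed vector spaces over the reals, which excludes ultrametric fields.)\<close>

class ultranormed_field = field_char_0 + metric_space +
  assumes dist_translate: "dist x y = dist (x - y) 0"
    and dist_mult_zero: "dist (x * y) 0 = dist x 0 * dist y 0"
    and dist_add_zero: "dist (x + y) 0 \<le> max (dist x 0) (dist y 0)"

definition absv :: "'a::ultranormed_field \<Rightarrow> real" where
  "absv x = dist x 0"

definition is_subfield :: "'a::field set \<Rightarrow> bool" where
  "is_subfield K \<longleftrightarrow> 0 \<in> K \<and> 1 \<in> K \<and>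
     (\<forall>x\<in>K. \<forall>y\<in>K. x + y \<in> K \<and> x * y \<in> K) \<and> (\<forall>x\<in>K. - x \<in> K \<and> inverse x \<in> K)"

definition is_algebraic_closure :: "'a::field set \<Rightarrow> 'a set \<Rightarrow> bool" where
  "is_algebraic_closure F K \<longleftrightarrow> is_subfield K \<and> F \<subseteq> K \<and>
     (\<forall>x\<in>K. \<exists>P. P \<noteq> 0 \<and> set (coeffs P) \<subseteq> F \<and> poly P x = 0) \<and>
     (\<forall>P. set (coeffs P) \<subseteq> K \<and> degree P > 0 \<longrightarrow> (\<exists>x\<in>K. poly P x = 0))"

text \<open>Inside a complete field whose absolute value restricts to the \<open>p\<close>-adic one on the rationals,
  the closure of the rationals is their completion, i.e. the field of \<open>p\<close>-adic numbers.\<close>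

definition Q_p :: "'a::ultranormed_field set" where
  "Q_p = closure \<rat>"

definition Z_p :: "'a::ultranormed_field set" where
  "Z_p = {x \<in> Q_p. absv x \<le> 1}"

text \<open>The type \<open>'a\<close> is (a copy of) the completion of an algebraic closure of the field of
  \<open>p\<close>-adic numbers. The first conjunct fixes the absolute value on the integers, hence on the
  rationals.\<close>

definition is_C_p :: "nat \<Rightarrow> 'a::ultranormed_field itself \<Rightarrow> bool" where
  "is_C_p p (_ :: 'a itself) \<longleftrightarrow>
     (\<forall>m::int. m \<noteq> 0 \<longrightarrow> absv (of_int m :: 'a) = 1 / real p ^ multiplicity (int p) m) \<and>
     complete (UNIV :: 'a set) \<and>
     (\<exists>K :: 'a set. is_algebraic_closure Q_p K \<and> closure K = UNIV)"

text \<open>The deformation function itself depends on the parameters: \<open>R a b\<close> is the two-variable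
  function attached to the parameters \<open>(a, b)\<close>. For instance \<open>R a b x y = (x - y) / (a - b)\<close> gives
  the numbers \<open>(a ^ n - b ^ n) / (a - b)\<close>. Thus \<open>dnum R (\<rho> ^ p) (q ^ p) k\<close> is
  in general different from \<open>dnum R \<rho> q (k * p)\<close>.\<close>

definition dnum :: "('a \<Rightarrow> 'a \<Rightarrow> 'a \<Rightarrow> 'a \<Rightarrow> 'a) \<Rightarrow> 'a \<Rightarrow> 'a \<Rightarrow> nat \<Rightarrow> 'a::field" where
  "dnum R a b n = R a b (a ^ n) (b ^ n)"

definition dfact :: "('a \<Rightarrow> 'a \<Rightarrow> 'a \<Rightarrow> 'a \<Rightarrow> 'a) \<Rightarrow> 'a \<Rightarrow> 'a \<Rightarrow> nat \<Rightarrow> 'a::field" where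
  "dfact R a b n = (\<Prod>j=1..n. dnum R a b j)"

definition gamma_prod ::
    "nat \<Rightarrow> ('a \<Rightarrow> 'a \<Rightarrow> 'a \<Rightarrow> 'a \<Rightarrow> 'a) \<Rightarrow> 'a \<Rightarrow> 'a \<Rightarrow> nat \<Rightarrow> 'a::field" where
  "gamma_prod p R a b n = (- 1) ^ n * (\<Prod>j | 1 \<le> j \<and> j < n \<and> coprime p j. dnum R a b j)"

text \<open>The filter says that \<open>n\<close> runs through the positive integers different from \<open>x\<close> and tends to
  \<open>x\<close> in the topology of \<open>'a\<close>. Outside \<open>Z_p\<close> the value carries no meaning.\<close>

definition padic_gamma ::
    "nat \<Rightarrow> ('a \<Rightarrow> 'a \<Rightarrow> 'a \<Rightarrow> 'a \<Rightarrow> 'a) \<Rightarrow> 'a \<Rightarrow> 'a \<Rightarrow> 'a \<Rightarrow> 'a::ultranormed_field" where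
  "padic_gamma p R a b x =
     Lim (inf (filtercomap of_nat (at x)) (principal {n. n > 0})) (gamma_prod p R a b)"

definition gamma_extends ::
    "nat \<Rightarrow> ('a \<Rightarrow> 'a \<Rightarrow> 'a \<Rightarrow> 'a \<Rightarrow> 'a) \<Rightarrow> 'a \<Rightarrow> 'a::ultranormed_field \<Rightarrow> bool" where
  "gamma_extends p R a b \<longleftrightarrow>
     (\<exists>G :: 'a \<Rightarrow> 'a. continuous_on Z_p G \<and> (\<forall>n>0. G (of_nat n) = gamma_prod p R a b n))"

end

theory Submission
  imports Defs
begin

text \<open>Two independent facts combine. The topological one: the gamma function at a positive
  integer \<open>m\<close> is defined as a limit over integers different from \<open>m\<close>, and the continuous
  extension to \<open>\<int>\<^sub>p\<close> forces this limit to be the value of the finite product at \<open>m\<close>, provided the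
  limit is unique, i.e. provided \<open>m\<close> is an accumulation point of the positive integers. It is one,
  because \<open>m + p ^ k\<close> tends to \<open>m\<close> (\<open>padic_gamma_of_nat\<close>).

  The arithmetic one: in \<open>[n]! = [1] \<cdots> [n]\<close> the factors at indices prime to \<open>p\<close> make up the
  gamma product, while the remaining indices are \<open>k p\<close> with \<open>1 \<le> k \<le> \<lfloor>n / p\<rfloor>\<close>, and the product
  rule splits each \<open>[k p]\<close> into a factor \<open>[p]\<close> and the number \<open>[k]\<close> for the parameters
  \<open>(\<rho> ^ p, q ^ p)\<close> (\<open>prod_split_coprime\<close>). Dividing by the nonzero second part gives the formula.\<close>

lemma absv_of_nat_prime_power:
  assumes "is_C_p p TYPE('a::ultranormed_field)" and "prime p"
  shows "absv (of_nat (p ^ k) :: 'a) = (1 / real p) ^ k"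
proof -
  have "int p ^ k \<noteq> 0" using assms(2) by (simp add: prime_gt_0_nat)
  moreover have "multiplicity (int p) (int p ^ k) = k"
    using assms(2) by (intro multiplicity_same_power) auto
  moreover have "absv (of_int (int p ^ k) :: 'a) =
      1 / real p ^ multiplicity (int p) (int p ^ k)"
    using assms(1) calculation(1) unfolding is_C_p_def by blast
  ultimately show ?thesis by (simp add: power_one_over)
qed

lemma of_nat_in_Z_p:
  assumes "is_C_p p TYPE('a::ultranormed_field)" and "prime p"
  shows "(of_nat m :: 'a) \<in> Z_p"
proof -
  have "(of_nat m :: 'a) \<in> closure \<rat>"
    using closure_subset by (meson Rats_of_nat subsetD)
  moreover have "absv (of_nat m :: 'a) \<le> 1"
  proof (cases "m = 0")
    case False
    then have "int m \<noteq> 0" by simp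
    then have "absv (of_int (int m) :: 'a) = 1 / real p ^ multiplicity (int p) (int m)"
      using assms(1) unfolding is_C_p_def by blast
    moreover have "real p ^ multiplicity (int p) (int m) \<ge> 1"
      using prime_gt_0_nat[OF assms(2)] by (intro one_le_power) simp
    ultimately show ?thesis using prime_gt_0_nat[OF assms(2)] by (simp add: divide_le_eq_1)
  qed (simp add: absv_def)
  ultimately show ?thesis by (simp add: Z_p_def Q_p_def)
qed

lemma add_prime_power_tendsto:
  assumes "is_C_p p TYPE('a::ultranormed_field)" and "prime p"
  shows "(\<lambda>k. of_nat (m + p ^ k) :: 'a) \<longlonglongrightarrow> of_nat m"
proof -
  have "dist (of_nat (m + p ^ k) :: 'a) (of_nat m) = (1 / real p) ^ k" for k
    using dist_translate[of "of_nat (m + p ^ k) :: 'a" "of_nat m"]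
      absv_of_nat_prime_power[OF assms, of k]
    by (simp add: absv_def)
  moreover have "(\<lambda>k. (1 / real p) ^ k) \<longlonglongrightarrow> 0"
    using prime_gt_1_nat[OF assms(2)] by (intro LIMSEQ_power_zero) simp
  ultimately show ?thesis by (subst tendsto_dist_iff) simp
qed

text \<open>Without this the limit defining the gamma function would not be unique.\<close>

lemma nat_approach_filter_nontrivial:
  assumes "is_C_p p TYPE('a::ultranormed_field)" and "prime p"
  shows "inf (filtercomap of_nat (at (of_nat m :: 'a))) (principal {n. n > 0}) \<noteq> bot"
    (is "?F \<noteq> bot")
proof
  assume "?F = bot"
  moreover have "filterlim (\<lambda>k. m + p ^ k) ?F sequentially"
    unfolding filterlim_inf filterlim_filtercomap_iff filterlim_principal filterlim_at o_def
    using add_prime_power_tendsto[OF assms, of m] prime_gt_0_nat[OF assms(2)] by simp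
  ultimately show False
    by (metis filterlim_def filtermap_bot_iff bot.extremum_unique trivial_limit_sequentially)
qed

lemma padic_gamma_of_nat:
  fixes a b :: "'a::ultranormed_field"
  assumes "is_C_p p TYPE('a)" and "prime p" and "gamma_extends p R a b" and "m > 0"
  shows "padic_gamma p R a b (of_nat m) = gamma_prod p R a b m"
proof -
  let ?F = "inf (filtercomap of_nat (at (of_nat m :: 'a))) (principal {n. n > 0})"
  obtain G :: "'a \<Rightarrow> 'a" where cont: "continuous_on Z_p G"
    and G: "\<And>n. n > 0 \<Longrightarrow> G (of_nat n) = gamma_prod p R a b n"
    using assms(3) unfolding gamma_extends_def by blast
  have "filterlim of_nat (at (of_nat m :: 'a)) ?F"
    by (rule filterlim_mono[OF filterlim_filtercomap order_refl inf_le1])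
  then have "filterlim of_nat (at (of_nat m :: 'a) within Z_p) ?F"
    using of_nat_in_Z_p[OF assms(1,2)] by (simp add: filterlim_at)
  moreover have "(G \<longlongrightarrow> G (of_nat m)) (at (of_nat m) within Z_p)"
    using cont of_nat_in_Z_p[OF assms(1,2)] by (simp add: continuous_on_def)
  ultimately have "((\<lambda>n. G (of_nat n)) \<longlongrightarrow> G (of_nat m)) ?F"
    by (rule filterlim_compose[rotated])
  moreover have "eventually (\<lambda>n. G (of_nat n) = gamma_prod p R a b n) ?F"
    unfolding eventually_inf_principal using G by simp
  ultimately have "(gamma_prod p R a b \<longlongrightarrow> gamma_prod p R a b m) ?F"
    unfolding G[OF assms(4)] by (rule Lim_transform_eventually)
  with nat_approach_filter_nontrivial[OF assms(1,2)] show ?thesis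
    unfolding padic_gamma_def by (rule tendsto_Lim)
qed

text \<open>By induction on \<open>n\<close>: the factor at \<open>Suc n\<close> joins the first product if \<open>p\<close> does not divide
  \<open>Suc n\<close>; otherwise \<open>Suc n = k * p\<close>, the quotient \<open>n div p\<close> rises by one to \<open>k\<close>, and the product
  rule supplies exactly the new factors \<open>c\<close> and \<open>g k\<close>.\<close>

lemma prod_split_coprime:
  fixes f g :: "nat \<Rightarrow> 'a::comm_monoid_mult"
  assumes "prime p" and rule: "\<And>k. k \<ge> 1 \<Longrightarrow> f (k * p) = g k * c"
  shows "(\<Prod>j=1..n. f j) =
    (\<Prod>j | 1 \<le> j \<and> j < n + 1 \<and> coprime p j. f j) * (c ^ (n div p) * (\<Prod>k=1..n div p. g k))"
proof (induction n)
  case 0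
  have "{j. 1 \<le> j \<and> j < 0 + 1 \<and> coprime p j} = {}" by auto
  then show ?case by (simp only: prod.empty) simp
next
  case (Suc n)
  let ?C = "\<lambda>n. {j. 1 \<le> j \<and> j < n + 1 \<and> coprime p j}"
  show ?case
  proof (cases "p dvd Suc n")
    case True
    then have "\<not> coprime p (Suc n)"
      using assms(1) by (metis coprime_absorb_left not_prime_unit)
    then have C: "?C (Suc n) = ?C n" by (auto simp: less_Suc_eq)
    have d: "Suc n div p = Suc (n div p)" using True by (simp add: div_Suc dvd_eq_mod_eq_0)
    have "Suc n = Suc (n div p) * p" using True d by (metis dvd_div_mult_self)
    then have "f (Suc n) = g (Suc (n div p)) * c" using rule[of "Suc (n div p)"] by simp
    then show ?thesis unfolding C d by (simp add: Suc.IH[simplified] mult_ac)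
  next
    case False
    then have "coprime p (Suc n)" using assms(1) by (simp add: prime_imp_coprime)
    then have C: "?C (Suc n) = insert (Suc n) (?C n)" by auto
    have d: "Suc n div p = n div p" using False by (simp add: div_Suc dvd_eq_mod_eq_0)
    show ?thesis unfolding C d by (simp add: Suc.IH[simplified] mult_ac)
  qed
qed

theorem theorem7p8:
  fixes p n :: nat
    and \<rho> q :: "'a::ultranormed_field"
    and R :: "'a \<Rightarrow> 'a \<Rightarrow> 'a \<Rightarrow> 'a \<Rightarrow> 'a"
  assumes "prime p" and "odd p"
    and "is_C_p p TYPE('a)"
    and "absv (\<rho> - 1) < 1" and "absv (q - 1) < 1" and "\<rho> \<noteq> 1" and "q \<noteq> 1"
    and "\<And>k. k \<ge> 1 \<Longrightarrow> dnum R \<rho> q (k * p) = dnum R (\<rho> ^ p) (q ^ p) k * dnum R \<rho> q p"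
    and "\<And>m. m \<ge> 1 \<Longrightarrow> dnum R \<rho> q m \<noteq> 0"
    and "\<And>k. k \<ge> 1 \<Longrightarrow> dnum R (\<rho> ^ p) (q ^ p) k \<noteq> 0"
    and "gamma_extends p R \<rho> q"
  shows "padic_gamma p R \<rho> q (of_nat (n + 1)) =
    (- 1) ^ (n + 1) *
      (dfact R \<rho> q n /
        (dnum R \<rho> q p ^ nat \<lfloor>real n / real p\<rfloor> *
         dfact R (\<rho> ^ p) (q ^ p) (nat \<lfloor>real n / real p\<rfloor>)))"
proof -
  let ?d = "n div p"
  let ?P = "\<Prod>j | 1 \<le> j \<and> j < n + 1 \<and> coprime p j. dnum R \<rho> q j"
  let ?D = "dnum R \<rho> q p ^ ?d * dfact R (\<rho> ^ p) (q ^ p) ?d"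
  have fl: "nat \<lfloor>real n / real p\<rfloor> = ?d" by (simp add: floor_divide_of_nat_eq)
  have "dfact R \<rho> q n = ?P * ?D"
    unfolding dfact_def using assms(8) by (intro prod_split_coprime[OF assms(1)])
  moreover have "?D \<noteq> 0"
    using assms(9)[of p] assms(10) prime_gt_0_nat[OF assms(1)] by (simp add: dfact_def)
  ultimately have "?P = dfact R \<rho> q n / ?D" by (simp add: eq_divide_eq)
  moreover have "padic_gamma p R \<rho> q (of_nat (n + 1)) = (- 1) ^ (n + 1) * ?P"
    using padic_gamma_of_nat[OF assms(3,1,11), of "n + 1"] by (simp only: gamma_prod_def)
  ultimately show ?thesis unfolding fl by (simp only:)
qed

end
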